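(* Let $\mathcal C$ be a binary linear block code of length $n$ used with BPSK over an AWGN channel with noise variance $\sigma^2>0$ per component. Let $\underline c^{(0)}$ be the all-zero codeword with bipolar image $\underline s^{(0)}$, and let $\underline c^{(1)},\underline c^{(2)}$ be two distinct codewords of Hamming weight $d\ge1$ with bipolar images $\underline s^{(1)},\underline s^{(2)}$. Let $\theta$ be the angle formed by the vectors $\underline s^{(1)}-\underline s^{(0)}$ and $\underline s^{(2)}-\underline s^{(0)}$. Then the triplet-wise error probability is $$\Pr\{E_{0\to1}\cup E_{0\to2}\}=Q(\sqrt d/\sigma)+\int_{\sqrt d}^{+\infty}f(\xi_1)\int_{-\infty}^{\frac{\sqrt d-\xi_1\cos\theta}{\sin\theta}}f(\xi_2)\,d\xi_2\,d\xi_1,$$ where $f(x)=\frac1{\sqrt{2\pi}\,\sigma}e^{-x^2/(2\sigma^2)}$. Furthermore, for fixed $d$ and $\sigma$, the triplet-wise error probability (the right-hand side above) is a non-decreasing function of $\theta\in(0,\pi)$.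
   Context: The BPSK map is $\phi:\mathbb F_2^n\to\{-1,+1\}^n$, $\phi(\underline v)_t=1-2v_t$; the bipolar image of $\underline c^{(\ell)}$ is $\underline s^{(\ell)}=\phi(\underline c^{(\ell)})$. The all-zero codeword is transmitted; the received vector is $\underline y=\underline s^{(0)}+\underline z$, with $\underline z$ having i.i.d. $\mathcal N(0,\sigma^2)$ components. $E_{0\to\ell}$ is the event that $\underline s^{(\ell)}$ is nearer to $\underline y$ (in Euclidean distance) than $\underline s^{(0)}$. $Q(x)=\int_x^{\infty}\frac1{\sqrt{2\pi}}e^{-z^2/2}\,dz$. *)

theory Defs
  imports "HOL-Probability.Probability" "HOL-Library.Z2"
begin

definition hamming_weight :: "bit ^ 'n \<Rightarrow> nat" where
  "hamming_weight v = card {t. v $ t \<noteq> 0}"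

definition bpsk :: "bit ^ 'n \<Rightarrow> real ^ 'n" where
  "bpsk v = (\<chi> t. 1 - 2 * of_bit (v $ t))"

text \<open>The value is \<open>pi / 2\<close> if \<open>u\<close> or \<open>v\<close> is zero.\<close>

definition vec_angle :: "'a::real_inner \<Rightarrow> 'a \<Rightarrow> real" where
  "vec_angle u v = arccos (u \<bullet> v / (norm u * norm v))"

definition awgn :: "'w measure \<Rightarrow> real \<Rightarrow> ('w \<Rightarrow> real ^ 'n) \<Rightarrow> bool" where
  "awgn M \<sigma> z \<longleftrightarrow>
     prob_space.indep_vars M (\<lambda>t. borel) (\<lambda>t w. z w $ t) UNIV \<and>
     (\<forall>t. distributed M lborel (\<lambda>w. z w $ t) (\<lambda>x. ennreal (normal_density 0 \<sigma> x)))"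

text \<open>The event that \<open>s'\<close> is nearer to the received vector \<open>y\<close> than the transmitted \<open>s\<close>.\<close>

definition error_event :: "'w measure \<Rightarrow> ('w \<Rightarrow> real ^ 'n) \<Rightarrow> real ^ 'n \<Rightarrow> real ^ 'n \<Rightarrow> 'w set" where
  "error_event M y s s' = {w \<in> space M. dist (y w) s' < dist (y w) s}"

definition Q :: "real \<Rightarrow> real" where
  "Q x = (LBINT z:{x..}. 1 / sqrt (2 * pi) * exp (- z\<^sup>2 / 2))"

definition gauss :: "real \<Rightarrow> real \<Rightarrow> real" where
  "gauss \<sigma> x = 1 / (sqrt (2 * pi) * \<sigma>) * exp (- x\<^sup>2 / (2 * \<sigma>\<^sup>2))"

definition triplet_error :: "nat \<Rightarrow> real \<Rightarrow> real \<Rightarrow> real" where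
  "triplet_error d \<sigma> \<theta> =
     Q (sqrt (real d) / \<sigma>) +
     (LBINT x1:{sqrt (real d)..}. gauss \<sigma> x1 *
        (LBINT x2:{..(sqrt (real d) - x1 * cos \<theta>) / sin \<theta>}. gauss \<sigma> x2))"

end

(*
  The law of the noise has a density that depends on the norm only, and the Lebesgue measure is
  invariant under orthogonal maps (it is the only translation-invariant measure with its value on
  the unit ball), so the law of the noise is rotation invariant. Two reflections move the normalised
  differences u, v of the bipolar images to e_i and cos \<theta> e_i + sin \<theta> e_j, and the event
  {u . z > a} \<union> {v . z > a} with a = sqrt d splits into {v . z > a}, of probability Q (a / \<sigma>), and
  {u . z > a, v . z \<le> a}, whose probability is the iterated integral by Fubini.
  Monotonicity holds already pointwise: for x \<ge> a \<ge> 0 the inner limit of integration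
  (a - x cos \<theta>) / sin \<theta> is non-decreasing in \<theta>.
*)

theory Submission
  imports Defs
begin

section \<open>Reflections and orthogonal maps\<close>

definition reflection :: "'a::real_inner \<Rightarrow> 'a \<Rightarrow> 'a" where
  "reflection v x = x - (2 * (v \<bullet> x) / (v \<bullet> v)) *\<^sub>R v"

lemma orthogonal_transformation_reflection: "orthogonal_transformation (reflection v)"
proof (cases "v = 0")
  \<comment> \<open>Division by zero yields 0, so reflecting along the zero vector is the identity.
    The case \<open>a = b\<close> of \<open>reflection_swap\<close> relies on this as well.\<close>
  case True
  then have "reflection v = (\<lambda>x. x)" by (simp add: reflection_def fun_eq_iff)
  then show ?thesis by simp
next
  case False
  define k where "k = 2 / (v \<bullet> v)"
  have reflection: "reflection v x = x - (k * (v \<bullet> x)) *\<^sub>R v" for x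
    by (simp add: reflection_def k_def)
  have kv: "k * (v \<bullet> v) = 2"
    using False by (simp add: k_def)
  have "linear (reflection v)"
  proof (rule linearI)
    show "reflection v (x + y) = reflection v x + reflection v y" for x y
      by (simp add: reflection inner_add_right distrib_left scaleR_add_left)
    show "reflection v (r *\<^sub>R x) = r *\<^sub>R reflection v x" for r x
      by (simp add: reflection scaleR_diff_right mult.left_commute)
  qed
  moreover have "reflection v x \<bullet> reflection v y = x \<bullet> y" for x y
  proof -
    \<comment> \<open>The defect from \<open>x \<bullet> y\<close> carries the factor
      \<open>2 - k * (v \<bullet> v)\<close>, which vanishes by the choice of
      \<open>k\<close>.\<close>
    have "reflection v x \<bullet> reflection v y =
        x \<bullet> y - k * (v \<bullet> x) * (v \<bullet> y) * (2 - k * (v \<bullet> v))"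
      unfolding reflection inner_diff_left inner_diff_right inner_scaleR_left inner_scaleR_right
        inner_commute[of x v] by algebra
    then show ?thesis by (simp add: kv)
  qed
  ultimately show ?thesis
    by (simp add: orthogonal_transformation_def)
qed

text \<open>Equal norms make \<open>a - b\<close> orthogonal to \<open>a + b\<close>, so the
  hyperplane orthogonal to \<open>a - b\<close> is the mirror between the two vectors. In the
  formula, the coefficient of \<open>a - b\<close> is exactly 1.\<close>

lemma reflection_swap:
  assumes "norm a = norm b"
  shows "reflection (a - b) a = b"
proof (cases "a = b")
  case False
  have "(a - b) \<bullet> (a - b) = 2 * ((a - b) \<bullet> a)"
    using assms by (simp add: inner_simps inner_commute norm_eq)
  moreover have "(a - b) \<bullet> (a - b) \<noteq> 0" using False by simp
  ultimately show ?thesis by (simp add: reflection_def)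
qed (simp add: reflection_def)

text \<open>Two reflections suffice: \<open>R\<close> takes \<open>u\<close> to \<open>u'\<close>,
  and the second one takes \<open>R v\<close> to \<open>v'\<close>. Since
  \<open>R v \<bullet> u' = u \<bullet> v = v' \<bullet> u'\<close>, the mirror of the second
  contains \<open>u'\<close>, so the first success is not undone.\<close>

lemma orthogonal_transformation_pair_exists:
  fixes u v u' v' :: "'a::real_inner"
  assumes "norm u = norm u'" "norm v = norm v'" "u \<bullet> v = u' \<bullet> v'"
  obtains T where "orthogonal_transformation T" "T u = u'" "T v = v'"
proof -
  define R where "R = reflection (u - u')"
  have R: "orthogonal_transformation R"
    unfolding R_def by (rule orthogonal_transformation_reflection)
  have Ru: "R u = u'"
    unfolding R_def by (rule reflection_swap) fact
  have "norm (R v) = norm v'"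
    using R assms(2) by (simp add: orthogonal_transformation)
  then have "reflection (R v - v') (R v) = v'"
    by (rule reflection_swap)
  moreover have "(R v - v') \<bullet> u' = 0"
    using R Ru assms(3) by (metis inner_commute inner_diff_right orthogonal_transformation_def right_minus_eq)
  then have "reflection (R v - v') u' = u'"
    by (simp add: reflection_def)
  ultimately show thesis
    using that[of "reflection (R v - v') \<circ> R"] R Ru
    by (simp add: orthogonal_transformation_compose orthogonal_transformation_reflection)
qed

section \<open>Invariance of Lebesgue measure under orthogonal maps\<close>

lemma borel_measurable_orthogonal_transformation:
  fixes T :: "'a::euclidean_space \<Rightarrow> 'a"
  assumes "orthogonal_transformation T"
  shows "T \<in> borel_measurable borel"
proof -
  have "bounded_linear T"
    using assms by (simp add: orthogonal_transformation_linear linear_conv_bounded_linear[symmetric])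
  then show ?thesis
    by (intro borel_measurable_continuous_onI linear_continuous_on)
qed

text \<open>Integrate \<open>indicator A (x + y) * indicator B y\<close> over the product of both measures, in either
  order, with \<open>B\<close> the unit ball, which is symmetric.\<close>
lemma translation_invariant_eq_lborel:
  fixes N :: "'a::euclidean_space measure"
  assumes fin: "sigma_finite_measure N" and sets_N [measurable_cong]: "sets N = sets borel"
    and trans: "\<And>c. distr N borel ((+) c) = N"
    and ball: "emeasure N (ball 0 1) = emeasure lborel (ball (0::'a) 1)"
  shows "N = lborel"
proof (rule measure_eqI)
  interpret N: sigma_finite_measure N by fact
  interpret pair_sigma_finite N "lborel :: 'a measure" ..
  let ?B = "ball (0::'a) 1"
  fix A assume "A \<in> sets N"
  then have A [measurable]: "A \<in> sets borel" by (simp add: sets_N)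
  have [measurable]: "?B \<in> sets borel" by simp
  have shift_N: "(\<integral>\<^sup>+x. f x \<partial>N) = (\<integral>\<^sup>+x. f (c + x) \<partial>N)"
    if "f \<in> borel_measurable borel" for f :: "'a \<Rightarrow> ennreal" and c
  proof -
    have "(+) c \<in> N \<rightarrow>\<^sub>M borel"
      by (simp add: measurable_cong_sets[OF sets_N refl])
    then show ?thesis
      using that nn_integral_distr[of "(+) c" N borel f] by (simp add: trans)
  qed
  have shift_lborel: "(\<integral>\<^sup>+x. f x \<partial>lborel) = (\<integral>\<^sup>+x. f (c + x) \<partial>lborel)"
    if "f \<in> borel_measurable borel" for f :: "'a \<Rightarrow> ennreal" and c
    using that nn_integral_distr[of "(+) c" lborel borel f] by (simp add: lborel_distr_plus)
  \<comment> \<open>Shifting by \<open>y\<close> turns the argument \<open>y - x\<close> into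
    \<open>- x\<close>; symmetry of the ball removes the sign.\<close>
  have ball_N: "(\<integral>\<^sup>+x. indicator ?B (y - x) \<partial>N) = emeasure N ?B" for y
  proof -
    have "(\<integral>\<^sup>+x. indicator ?B (y - x) \<partial>N) = (\<integral>\<^sup>+x. indicator ?B (y - (y + x)) \<partial>N)"
      by (rule shift_N) measurable
    also have "\<dots> = (\<integral>\<^sup>+x. indicator ?B x \<partial>N)"
      by (intro nn_integral_cong) (simp add: indicator_def dist_norm)
    finally show ?thesis by (simp add: sets_N)
  qed
  have "emeasure N A * emeasure lborel ?B = (\<integral>\<^sup>+y. emeasure N A * indicator ?B y \<partial>lborel)"
    by (simp add: nn_integral_cmult)
  also have "\<dots> = (\<integral>\<^sup>+y. (\<integral>\<^sup>+x. indicator A (y + x) * indicator ?B y \<partial>N) \<partial>lborel)"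
  proof (rule nn_integral_cong)
    fix y :: 'a
    have "emeasure N A = (\<integral>\<^sup>+x. indicator A x \<partial>N)"
      by (simp add: sets_N)
    also have "\<dots> = (\<integral>\<^sup>+x. indicator A (y + x) \<partial>N)"
      by (rule shift_N) measurable
    finally show "emeasure N A * indicator ?B y = (\<integral>\<^sup>+x. indicator A (y + x) * indicator ?B y \<partial>N)"
      by (cases "y \<in> ?B") auto
  qed
  also have "\<dots> = (\<integral>\<^sup>+x. (\<integral>\<^sup>+y. indicator A (y + x) * indicator ?B y \<partial>lborel) \<partial>N)"
    by (rule Fubini') measurable
  also have "\<dots> = (\<integral>\<^sup>+x. (\<integral>\<^sup>+y. indicator A y * indicator ?B (y - x) \<partial>lborel) \<partial>N)"
  proof (rule nn_integral_cong)
    fix x :: 'a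
    have "(\<integral>\<^sup>+y. indicator A y * indicator ?B (y - x) \<partial>lborel) =
        (\<integral>\<^sup>+y. indicator A (x + y) * indicator ?B (x + y - x) \<partial>lborel)"
      by (rule shift_lborel) measurable
    then show "(\<integral>\<^sup>+y. indicator A (y + x) * indicator ?B y \<partial>lborel) =
        (\<integral>\<^sup>+y. indicator A y * indicator ?B (y - x) \<partial>lborel)"
      by (simp add: add.commute)
  qed
  also have "\<dots> = (\<integral>\<^sup>+y. (\<integral>\<^sup>+x. indicator A y * indicator ?B (y - x) \<partial>N) \<partial>lborel)"
    by (rule Fubini'[symmetric]) measurable
  also have "\<dots> = (\<integral>\<^sup>+y. indicator A y * emeasure N ?B \<partial>lborel)"
    by (intro nn_integral_cong) (auto simp: ball_N indicator_def[of A])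
  also have "\<dots> = emeasure lborel A * emeasure lborel ?B"
    by (subst nn_integral_multc) (auto simp: ball)
  finally have "emeasure N A * emeasure lborel ?B = emeasure lborel A * emeasure lborel ?B" .
  \<comment> \<open>The volume of the ball can be cancelled because it is neither zero nor
    infinite.\<close>
  moreover have "emeasure lborel ?B > 0"
    by (simp add: emeasure_ball)
  then have "emeasure lborel ?B \<noteq> 0" by simp
  moreover have "emeasure lborel ?B \<noteq> \<infinity>"
    using emeasure_lborel_ball_finite[of "0::'a" 1] by auto
  ultimately show "emeasure N A = emeasure lborel A"
    by (metis ennreal_mult_cancel_left mult.commute infinity_ennreal_def)
qed (simp add: sets_N)

lemma lborel_distr_orthogonal:
  fixes T :: "'a::euclidean_space \<Rightarrow> 'a"
  assumes T: "orthogonal_transformation T"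
  shows "distr lborel borel T = lborel"
proof (rule translation_invariant_eq_lborel)
  note [measurable] = borel_measurable_orthogonal_transformation[OF T]
  note lin = orthogonal_transformation_linear[OF T]
  have "emeasure (distr lborel borel T) (ball 0 r) = emeasure lborel (ball (0::'a) r)" for r
  proof -
    have "T -` ball 0 r = ball 0 r"
      using T by (auto simp: orthogonal_transformation)
    then show ?thesis by (simp add: emeasure_distr)
  qed
  note ball = this
  then show "emeasure (distr lborel borel T) (ball 0 1) = emeasure lborel (ball (0::'a) 1)" .
  show "distr (distr lborel borel T) borel ((+) c) = distr lborel borel T" for c
  proof -
    \<comment> \<open>A translation of the image is the image of a translation: by surjectivity and
      linearity, adding \<open>c\<close> after \<open>T\<close> equals adding \<open>b\<close>
      before it, and Lebesgue measure absorbs the latter.\<close>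
    obtain b where "c = T b" using orthogonal_transformation_surj[OF T] by (metis surjD)
    then have "(+) c \<circ> T = T \<circ> (+) b" by (auto simp: linear_add[OF lin])
    then have "distr (distr lborel borel T) borel ((+) c) = distr (distr lborel borel ((+) b)) borel T"
      by (simp add: distr_distr)
    then show ?thesis by (simp add: lborel_distr_plus)
  qed
  \<comment> \<open>Centred balls are their own preimages under \<open>T\<close>, so those of
    integer radius form a countable cover by sets of finite measure.\<close>
  show "sigma_finite_measure (distr lborel borel T)"
  proof
    let ?\<A> = "range (\<lambda>n. ball (0::'a) (real n))"
    have "\<Union> ?\<A> = UNIV"
      by (auto intro: reals_Archimedean2)
    then show "\<exists>A. countable A \<and> A \<subseteq> sets (distr lborel borel T) \<and>
        \<Union> A = space (distr lborel borel T) \<and> (\<forall>a\<in>A. emeasure (distr lborel borel T) a \<noteq> \<infinity>)"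
      using emeasure_lborel_ball_finite[of "0::'a"]
      by (intro exI[of _ ?\<A>]) (auto simp: ball less_top[symmetric])
  qed
qed simp

section \<open>The law of the noise vector\<close>

lemma PiM_density:
  fixes f :: "'i \<Rightarrow> 'a \<Rightarrow> ennreal"
  assumes "finite I" and M: "\<And>i. sigma_finite_measure (M i)"
    and dens: "\<And>i. sigma_finite_measure (density (M i) (f i))"
    and f [measurable]: "\<And>i. f i \<in> borel_measurable (M i)"
  shows "PiM I (\<lambda>i. density (M i) (f i)) = density (PiM I M) (\<lambda>x. \<Prod>i\<in>I. f i (x i))"
proof -
  interpret M: product_sigma_finite M by (simp add: M product_sigma_finite_def)
  interpret D: product_sigma_finite "\<lambda>i. density (M i) (f i)"
    by (simp add: dens product_sigma_finite_def)
  show ?thesis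
  \<comment> \<open>A finite product measure is determined by its values on boxes. The indicator of
    a box is a product over the coordinates, so the integral of the product density over it
    factorises.\<close>
  proof (rule D.PiM_eqI[symmetric])
    show "sets (density (PiM I M) (\<lambda>x. \<Prod>i\<in>I. f i (x i))) = sets (PiM I (\<lambda>i. density (M i) (f i)))"
      by (simp cong: sets_PiM_cong)
    fix A assume "\<And>i. i \<in> I \<Longrightarrow> A i \<in> sets (density (M i) (f i))"
    then have A [measurable]: "\<And>i. i \<in> I \<Longrightarrow> A i \<in> sets (M i)" by simp
    have PiE: "Pi\<^sub>E I A \<in> sets (PiM I M)" using assms(1) A by (rule sets_PiM_I_finite)
    have "emeasure (density (PiM I M) (\<lambda>x. \<Prod>i\<in>I. f i (x i))) (Pi\<^sub>E I A) =
        (\<integral>\<^sup>+x. (\<Prod>i\<in>I. f i (x i)) * indicator (Pi\<^sub>E I A) x \<partial>PiM I M)"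
      using PiE by (subst emeasure_density) auto
    also have "\<dots> = (\<integral>\<^sup>+x. (\<Prod>i\<in>I. f i (x i) * indicator (A i) (x i)) \<partial>PiM I M)"
    proof (rule nn_integral_cong)
      fix x assume "x \<in> space (PiM I M)"
      then have "indicator (Pi\<^sub>E I A) x = (\<Prod>i\<in>I. indicator (A i) (x i) :: ennreal)"
        using assms(1) by (auto simp: indicator_def space_PiM PiE_iff)
      then show "(\<Prod>i\<in>I. f i (x i)) * indicator (Pi\<^sub>E I A) x =
          (\<Prod>i\<in>I. f i (x i) * indicator (A i) (x i))"
        by (simp add: prod.distrib)
    qed
    also have "\<dots> = (\<Prod>i\<in>I. \<integral>\<^sup>+x. f i x * indicator (A i) x \<partial>M i)"
      using assms(1) by (rule M.product_nn_integral_prod) measurable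
    also have "\<dots> = (\<Prod>i\<in>I. emeasure (density (M i) (f i)) (A i))"
      by (intro prod.cong refl) (simp add: emeasure_density A)
    finally show "emeasure (density (PiM I M) (\<lambda>x. \<Prod>i\<in>I. f i (x i))) (Pi\<^sub>E I A) =
        (\<Prod>i\<in>I. emeasure (density (M i) (f i)) (A i))" .
  qed fact
qed

lemma measurable_vec_lambda:
  assumes "\<And>i. (\<lambda>x. f x i) \<in> borel_measurable M"
  shows "(\<lambda>x. (\<chi> i. f x i) :: real ^ 'n) \<in> borel_measurable M"
  using assms by (subst borel_measurable_euclidean_space) (auto simp: Basis_vec_def inner_axis)

text \<open>Bridge from function spaces, where independence yields a product measure, to vectors.
  Lebesgue measure is determined by open boxes, and the preimage of a box is a product of open
  intervals.\<close>

lemma lborel_vec_eq_PiM: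
  "(lborel :: (real ^ 'n) measure) = distr (PiM UNIV (\<lambda>_. lborel)) borel (\<lambda>f. \<chi> i. f i)"
proof (rule lborel_eqI)
  interpret product_sigma_finite "\<lambda>_::'n. lborel :: real measure"
    by (simp add: product_sigma_finite_def sigma_finite_lborel)
  fix l u :: "real ^ 'n"
  assume "\<And>b. b \<in> Basis \<Longrightarrow> l \<bullet> b \<le> u \<bullet> b"
  then have le: "l $ i \<le> u $ i" for i
    by (metis axis_in_Basis_iff inner_axis' inner_commute inner_real_def mult.right_neutral Basis_real_def singletonI)
  have [measurable]: "(\<lambda>f. (\<chi> i. f i) :: real ^ 'n) \<in> PiM UNIV (\<lambda>_. lborel) \<rightarrow>\<^sub>M borel"
    by (rule measurable_vec_lambda) simp
  have "(\<lambda>f. (\<chi> i. f i) :: real ^ 'n) -` box l u \<inter> space (PiM UNIV (\<lambda>_. lborel)) =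
      Pi\<^sub>E UNIV (\<lambda>i. {l $ i <..< u $ i})"
    by (auto simp: mem_box_cart space_PiM PiE_iff)
  then have "emeasure (distr (PiM UNIV (\<lambda>_. lborel)) borel (\<lambda>f. (\<chi> i. f i) :: real ^ 'n)) (box l u) =
      (\<Prod>i\<in>UNIV. ennreal (u $ i - l $ i))"
    by (simp add: emeasure_distr emeasure_PiM le)
  also have "\<dots> = (\<Prod>b\<in>Basis. (u - l) \<bullet> b)"
    by (simp add: prod_ennreal le axis_eq_axis Basis_vec_def inner_axis prod.UNION_disjoint)
  finally show "emeasure (distr (PiM UNIV (\<lambda>_. lborel)) borel (\<lambda>f. (\<chi> i. f i) :: real ^ 'n)) (box l u) =
      (\<Prod>b\<in>Basis. (u - l) \<bullet> b)" .
qed simp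

text \<open>The exponents add up to the squared norm; this is the source of the rotation
  invariance.\<close>

lemma prod_normal_density:
  fixes x :: "real ^ 'n"
  shows "(\<Prod>i\<in>UNIV. normal_density 0 \<sigma> (x $ i)) =
    (1 / sqrt (2 * pi * \<sigma>\<^sup>2)) ^ CARD('n) * exp (- (norm x)\<^sup>2 / (2 * \<sigma>\<^sup>2))"
proof -
  have "(norm x)\<^sup>2 = (\<Sum>i\<in>UNIV. (x $ i)\<^sup>2)"
    by (simp add: norm_vec_def L2_set_def real_sqrt_pow2 sum_nonneg)
  then have "- (norm x)\<^sup>2 / (2 * \<sigma>\<^sup>2) = (\<Sum>i\<in>UNIV. - (x $ i)\<^sup>2 / (2 * \<sigma>\<^sup>2))"
    by (simp add: sum_negf sum_divide_distrib)
  then show ?thesis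
    by (simp add: normal_density_def prod.distrib exp_sum power_one_over prod_dividef del: minus_divide_left)
qed

lemma (in prob_space) awgn_component:
  assumes "awgn M \<sigma> z"
  shows "distributed M lborel (\<lambda>w. z w $ t) (\<lambda>x. ennreal (normal_density 0 \<sigma> x))"
  using assms by (simp add: awgn_def)

lemma (in prob_space) awgn_measurable:
  assumes "awgn M \<sigma> z"
  shows "z \<in> borel_measurable M"
proof -
  have "(\<lambda>w. \<chi> t. z w $ t) \<in> borel_measurable M"
    using distributed_measurable[OF awgn_component[OF assms]] by (intro measurable_vec_lambda) simp
  then show ?thesis by simp
qed

lemma (in prob_space) awgn_distr:
  fixes z :: "'a \<Rightarrow> real ^ 'n"
  assumes "awgn M \<sigma> z" "\<sigma> > 0"
  shows "distr M borel z = density lborel (\<lambda>x. ennreal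
    ((1 / sqrt (2 * pi * \<sigma>\<^sup>2)) ^ CARD('n) * exp (- (norm x)\<^sup>2 / (2 * \<sigma>\<^sup>2))))"
proof -
  let ?g = "\<lambda>x. ennreal (normal_density 0 \<sigma> x)"
  have rv [measurable]: "(\<lambda>w. z w $ t) \<in> borel_measurable M" for t
    using distributed_measurable[OF awgn_component[OF assms(1)]] by simp
  have vec [measurable]: "(\<lambda>f. (\<chi> i. f i) :: real ^ 'n) \<in> PiM UNIV (\<lambda>_. borel) \<rightarrow>\<^sub>M borel"
    by (rule measurable_vec_lambda) simp
  have [measurable]: "(\<lambda>f. (\<chi> i. f i) :: real ^ 'n) \<in> PiM UNIV (\<lambda>_. lborel) \<rightarrow>\<^sub>M borel"
    by (rule measurable_vec_lambda) simp
  have "indep_vars (\<lambda>t. borel) (\<lambda>t w. z w $ t) UNIV"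
    using assms(1) by (simp add: awgn_def)
  then have "distr M (PiM UNIV (\<lambda>_. borel)) (\<lambda>w. \<lambda>t\<in>UNIV. z w $ t) =
      PiM UNIV (\<lambda>t. distr M borel (\<lambda>w. z w $ t))"
    using rv by (subst (asm) indep_vars_iff_distr_eq_PiM) auto
  also have "\<dots> = PiM UNIV (\<lambda>t::'n. density lborel ?g)"
    using distributed_distr_eq_density[OF awgn_component[OF assms(1)]]
    by (intro PiM_cong refl) (simp cong: distr_cong)
  also have "\<dots> = density (PiM UNIV (\<lambda>_. lborel)) (\<lambda>x. \<Prod>t\<in>UNIV. ?g (x t))"
    using prob_space_normal_density[OF assms(2), of 0]
    by (intro PiM_density)
      (auto simp: sigma_finite_lborel prob_space_def finite_measure_def)
  finally have PiM: "distr M (PiM UNIV (\<lambda>_. borel)) (\<lambda>w. \<lambda>t\<in>UNIV. z w $ t) =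
      density (PiM UNIV (\<lambda>_. lborel)) (\<lambda>x. \<Prod>t\<in>UNIV. ?g (x t))" .
  \<comment> \<open>The vector \<open>z w\<close> is rebuilt from the function of its coordinates,
    so its law is the image of the product law. The density passes through this map since it depends
    on the rebuilt vector.\<close>
  have "distr M borel z = distr (distr M (PiM UNIV (\<lambda>_. borel)) (\<lambda>w. \<lambda>t\<in>UNIV. z w $ t)) borel (\<lambda>f. \<chi> i. f i)"
    by (subst distr_distr) (auto simp: comp_def, simp add: restrict_def)
  also have "\<dots> = density (distr (PiM UNIV (\<lambda>_. lborel)) borel (\<lambda>f. \<chi> i. f i)) (\<lambda>x. \<Prod>t\<in>UNIV. ?g (x $ t))"
    unfolding PiM by (subst density_distr) (auto)
  also have "\<dots> = density lborel (\<lambda>x. \<Prod>t\<in>UNIV. ?g (x $ t))"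
    by (simp add: lborel_vec_eq_PiM[symmetric])
  finally show ?thesis
    by (simp add: prod_ennreal prod_normal_density)
qed

lemma (in prob_space) awgn_orthogonal:
  fixes z :: "'a \<Rightarrow> real ^ 'n"
  assumes z: "awgn M \<sigma> z" "\<sigma> > 0" and T: "orthogonal_transformation T"
  shows "distr M borel (\<lambda>w. T (z w)) = distr M borel z"
proof -
  note [measurable] = awgn_measurable[OF z(1)] borel_measurable_orthogonal_transformation[OF T]
  have "distr M borel (\<lambda>w. T (z w)) = distr (distr M borel z) borel T"
    by (simp add: distr_distr comp_def)
  \<comment> \<open>Because \<open>T\<close> preserves norms, the density factors through
    \<open>T\<close>, and only the base measure is pushed forward.\<close>
  also have "\<dots> = density (distr lborel borel T) (\<lambda>x. ennreal
      ((1 / sqrt (2 * pi * \<sigma>\<^sup>2)) ^ CARD('n) * exp (- (norm x)\<^sup>2 / (2 * \<sigma>\<^sup>2))))"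
    using T by (subst density_distr) (auto simp: awgn_distr[OF z] orthogonal_transformation)
  finally show ?thesis
    by (simp add: lborel_distr_orthogonal[OF T] awgn_distr[OF z])
qed

section \<open>Gaussian probabilities in one and two dimensions\<close>

lemma gauss_eq_normal_density: "\<sigma> > 0 \<Longrightarrow> gauss \<sigma> = normal_density 0 \<sigma>"
  by (simp add: gauss_def normal_density_def real_sqrt_mult fun_eq_iff)

lemma (in prob_space) normal_tail_eq_Q:
  assumes "distributed M lborel X (\<lambda>x. ennreal (normal_density 0 \<sigma> x))" "\<sigma> > 0"
  shows "prob {w \<in> space M. a < X w} = Q (a / \<sigma>)"
proof -
  \<comment> \<open>Standardising reduces the tail to the standard normal law; the mean 0 is kept
    explicit to match the conversion rule.\<close>
  have "distributed M lborel (\<lambda>w. (X w - 0) / \<sigma>) (\<lambda>x. ennreal (std_normal_density x))"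
    using assms normal_standard_normal_convert[of \<sigma> X 0] by simp
  then have "emeasure M ((\<lambda>w. (X w - 0) / \<sigma>) -` {a / \<sigma><..} \<inter> space M) =
      (\<integral>\<^sup>+x. ennreal (std_normal_density x) * indicator {a / \<sigma><..} x \<partial>lborel)"
    by (rule distributed_emeasure) simp
  also have "\<dots> = (\<integral>\<^sup>+x. ennreal (indicator {a / \<sigma>..} x * std_normal_density x) \<partial>lborel)"
    \<comment> \<open>The event is a strict inequality while \<open>Q\<close> integrates over a
      closed half-line; the endpoint is a null set.\<close>
    using AE_lborel_singleton[of "a / \<sigma>"]
    by (intro nn_integral_cong_AE) (auto split: split_indicator)
  finally have "measure M ((\<lambda>w. (X w - 0) / \<sigma>) -` {a / \<sigma><..} \<inter> space M) =
      (LBINT x. indicator {a / \<sigma>..} x * std_normal_density x)"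
    by (subst integral_eq_nn_integral) (auto simp: measure_def)
  also have "\<dots> = Q (a / \<sigma>)"
    by (simp add: Q_def set_lebesgue_integral_def std_normal_density_def)
  also have "(\<lambda>w. (X w - 0) / \<sigma>) -` {a / \<sigma><..} \<inter> space M = {w \<in> space M. a < X w}"
    using assms(2) by (auto simp: divide_less_cancel)
  finally show ?thesis .
qed

text \<open>Isolates the inner integral of \<open>triplet_error\<close>, so that monotonicity,
  bounds and measurability of a distribution function become available.\<close>

definition gauss_cdf :: "real \<Rightarrow> real \<Rightarrow> real" where
  "gauss_cdf \<sigma> t = (LBINT x:{..t}. gauss \<sigma> x)"

lemma gauss_cdf_eq_measure:
  assumes "\<sigma> > 0"
  shows "gauss_cdf \<sigma> t = measure (density lborel (\<lambda>x. ennreal (normal_density 0 \<sigma> x))) {..t}"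
proof -
  have "measure (density lborel (\<lambda>x. ennreal (normal_density 0 \<sigma> x))) {..t} =
      enn2real (\<integral>\<^sup>+x. ennreal (indicator {..t} x * normal_density 0 \<sigma> x) \<partial>lborel)"
    by (simp add: measure_def emeasure_density)
      (auto intro!: arg_cong[where f = enn2real] nn_integral_cong split: split_indicator)
  then show ?thesis
    using assms by (simp add: gauss_cdf_def set_lebesgue_integral_def gauss_eq_normal_density integral_eq_nn_integral)
qed

lemma
  assumes "\<sigma> > 0"
  shows mono_gauss_cdf: "mono (gauss_cdf \<sigma>)"
    and gauss_cdf_nonneg: "0 \<le> gauss_cdf \<sigma> t"
    and gauss_cdf_le_1: "gauss_cdf \<sigma> t \<le> 1"
proof -
  interpret prob_space "density lborel (\<lambda>x. ennreal (normal_density 0 \<sigma> x))"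
    using assms by (rule prob_space_normal_density)
  show "mono (gauss_cdf \<sigma>)"
    by (rule monoI) (auto simp: gauss_cdf_eq_measure assms intro!: finite_measure_mono)
  show "0 \<le> gauss_cdf \<sigma> t" "gauss_cdf \<sigma> t \<le> 1"
    by (simp_all add: gauss_cdf_eq_measure assms)
qed

lemma measurable_gauss_cdf: "\<sigma> > 0 \<Longrightarrow> gauss_cdf \<sigma> \<in> borel_measurable borel"
  by (rule borel_measurable_mono[OF mono_gauss_cdf])

text \<open>Independence makes the joint law a product, so the probability is the integral of the
  measures of the slices. As \<open>s > 0\<close>, the slice at \<open>x > a\<close> is the
  half-line up to \<open>(b - x * c) / s\<close>; the other slices are empty. In the application
  \<open>c\<close> and \<open>s\<close> are the cosine and sine of the angle.\<close>

lemma (in prob_space) normal_pair_wedge: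
  assumes indep: "indep_var borel X borel Y"
    and X: "distributed M lborel X (\<lambda>x. ennreal (normal_density 0 \<sigma> x))"
    and Y: "distributed M lborel Y (\<lambda>x. ennreal (normal_density 0 \<sigma> x))"
    and \<sigma>: "\<sigma> > 0" and s: "s > 0"
  shows "prob {w \<in> space M. a < X w \<and> c * X w + s * Y w \<le> b} =
    (LBINT x:{a..}. gauss \<sigma> x * gauss_cdf \<sigma> ((b - x * c) / s))"
proof -
  define N where "N = density lborel (\<lambda>x. ennreal (normal_density 0 \<sigma> x))"
  interpret N: prob_space N
    unfolding N_def using \<sigma> by (rule prob_space_normal_density)
  have sets_N [measurable_cong, simp]: "sets N = sets borel" by (simp add: N_def)
  note [measurable] = measurable_gauss_cdf[OF \<sigma>]
  have [measurable]: "X \<in> borel_measurable M" "Y \<in> borel_measurable M"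
    using distributed_measurable[OF X] distributed_measurable[OF Y] by simp_all
  have "distr M borel X = N" "distr M borel Y = N"
    using distributed_distr_eq_density[OF X] distributed_distr_eq_density[OF Y]
    by (simp_all add: N_def cong: distr_cong)
  then have joint: "distr M (borel \<Otimes>\<^sub>M borel) (\<lambda>w. (X w, Y w)) = N \<Otimes>\<^sub>M N"
    using indep by (simp add: indep_var_distribution_eq)
  define S where "S = {(x, y). a < x \<and> c * x + s * y \<le> b}"
  have S [measurable]: "S \<in> sets (borel \<Otimes>\<^sub>M borel)"
  proof -
    have "S = {p \<in> space (borel \<Otimes>\<^sub>M borel). a < fst p \<and> c * fst p + s * snd p \<le> b}"
      by (auto simp: S_def space_pair_measure)
    also have "\<dots> \<in> sets (borel \<Otimes>\<^sub>M borel)"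
      by measurable
    finally show ?thesis .
  qed
  have S_N: "S \<in> sets (N \<Otimes>\<^sub>M N)"
    using S by (simp cong: sets_pair_measure_cong)
  have slice: "emeasure N (Pair x -` S) = ennreal (indicator {a<..} x * gauss_cdf \<sigma> ((b - x * c) / s))" for x
  proof -
    have "Pair x -` S = (if a < x then {..(b - x * c) / s} else {})"
      using s by (auto simp: S_def field_simps)
    then show ?thesis
      by (auto simp: gauss_cdf_eq_measure[OF \<sigma>] N_def[symmetric] N.emeasure_eq_measure)
  qed
  have "emeasure M {w \<in> space M. a < X w \<and> c * X w + s * Y w \<le> b} =
      emeasure (distr M (borel \<Otimes>\<^sub>M borel) (\<lambda>w. (X w, Y w))) S"
    by (subst emeasure_distr[OF _ S]) (measurable, auto simp: S_def intro!: arg_cong[where f = "emeasure M"])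
  also have "\<dots> = (\<integral>\<^sup>+x. emeasure N (Pair x -` S) \<partial>N)"
    unfolding joint by (rule N.emeasure_pair_measure_alt) (rule S_N)
  also have "\<dots> = (\<integral>\<^sup>+x. ennreal (normal_density 0 \<sigma> x) *
      ennreal (indicator {a<..} x * gauss_cdf \<sigma> ((b - x * c) / s)) \<partial>lborel)"
    unfolding slice by (subst N_def) (rule nn_integral_density; measurable)
  also have "\<dots> = (\<integral>\<^sup>+x. ennreal (indicator {a..} x * (gauss \<sigma> x * gauss_cdf \<sigma> ((b - x * c) / s))) \<partial>lborel)"
    using AE_lborel_singleton[of a]
    by (intro nn_integral_cong_AE)
      (auto simp: gauss_eq_normal_density[OF \<sigma>] ennreal_mult gauss_cdf_nonneg[OF \<sigma>] split: split_indicator)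
  finally show ?thesis
    unfolding set_lebesgue_integral_def real_scaleR_def
    by (subst integral_eq_nn_integral)
      (auto simp: measure_def gauss_eq_normal_density[OF \<sigma>] gauss_cdf_nonneg[OF \<sigma>])
qed

section \<open>Half-spaces and wedges under the noise law\<close>

lemma (in prob_space) awgn_indep_components:
  assumes "awgn M \<sigma> z" "i \<noteq> j"
  shows "indep_var borel (\<lambda>w. z w $ i) borel (\<lambda>w. z w $ j)"
proof -
  have "indep_vars (\<lambda>_. borel) (\<lambda>t w. z w $ t) (insert i {j})"
    by (rule indep_vars_subset[OF _ subset_UNIV]) (use assms(1) in \<open>simp add: awgn_def\<close>)
  \<comment> \<open>The rule separates one variable from the sum of the others; here that sum has
    the single term with index \<open>j\<close>.\<close>
  from indep_vars_sum[OF _ _ this] show ?thesis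
    using assms(2) by simp
qed

lemma (in prob_space)
  fixes z :: "'a \<Rightarrow> real ^ 'n" and i j :: 'n
  assumes z: "awgn M \<sigma> z" and \<sigma>: "\<sigma> > 0" and ij: "i \<noteq> j"
    and unit: "norm u = 1" "norm v = 1" and angle: "u \<bullet> v = cos \<theta>" and pos: "sin \<theta> > 0"
  shows awgn_halfspace: "prob {w \<in> space M. a < v \<bullet> z w} = Q (a / \<sigma>)"
    and awgn_wedge: "prob {w \<in> space M. a < u \<bullet> z w \<and> v \<bullet> z w \<le> a} =
      (LBINT x:{a..}. gauss \<sigma> x * gauss_cdf \<sigma> ((a - x * cos \<theta>) / sin \<theta>))"
proof -
  \<comment> \<open>The standard position of two unit vectors at angle \<open>\<theta>\<close>, in
    the plane of two distinct axes. There the inner products with the noise involve only two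
    independent components.\<close>
  define u' v' :: "real ^ 'n"
    where "u' = axis i 1" and "v' = cos \<theta> *\<^sub>R axis i 1 + sin \<theta> *\<^sub>R axis j 1"
  note [measurable] = awgn_measurable[OF z]
  have vv: "v' \<bullet> v' = 1"
    using ij sin_cos_squared_add[of \<theta>]
    by (simp add: v'_def inner_simps inner_axis_axis power2_eq_square algebra_simps)
  have uv: "u' \<bullet> v' = cos \<theta>"
    using ij by (simp add: u'_def v'_def inner_simps inner_axis_axis)
  obtain T where T: "orthogonal_transformation T" "T u = u'" "T v = v'"
    using orthogonal_transformation_pair_exists[of u u' v v'] unit angle vv uv
    by (auto simp: u'_def norm_eq_sqrt_inner[of v'])
  \<comment> \<open>The pair lemma, applied to a vector repeated twice, moves a single vector to the
    axis.\<close>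
  obtain R where R: "orthogonal_transformation R" "R v = u'"
    using orthogonal_transformation_pair_exists[of v u' v u'] unit by (auto simp: u'_def norm_eq_1 dot_square_norm)
  have law: "prob {w \<in> space M. P (L (z w))} = prob {w \<in> space M. P (z w)}"
    if "orthogonal_transformation L" and [measurable]: "Measurable.pred borel P" for L P
  proof -
    note [measurable] = borel_measurable_orthogonal_transformation[OF that(1)]
    have "prob {w \<in> space M. P (L (z w))} = measure (distr M borel (\<lambda>w. L (z w))) {x. P x}"
      by (subst measure_distr) (auto intro!: arg_cong[where f = prob])
    also have "\<dots> = prob {w \<in> space M. P (z w)}"
      unfolding awgn_orthogonal[OF z \<sigma> that(1)]
      by (subst measure_distr) (auto intro!: arg_cong[where f = prob])
    finally show ?thesis .
  qed
  have "v \<bullet> x = u' \<bullet> R x" for x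
    using R by (metis orthogonal_transformation_def)
  then have "prob {w \<in> space M. a < v \<bullet> z w} = prob {w \<in> space M. a < u' \<bullet> z w}"
    using law[OF R(1), of "\<lambda>x. a < u' \<bullet> x"] by simp
  then show "prob {w \<in> space M. a < v \<bullet> z w} = Q (a / \<sigma>)"
    using normal_tail_eq_Q[OF awgn_component[OF z] \<sigma>] by (simp add: u'_def inner_axis')
  \<comment> \<open>Rotating both the normals and the noise changes no inner product, and
    \<open>law\<close> replaces the rotated noise by the original one.\<close>
  have "u \<bullet> x = u' \<bullet> T x" "v \<bullet> x = v' \<bullet> T x" for x
    using T by (metis orthogonal_transformation_def)+
  then have "prob {w \<in> space M. a < u \<bullet> z w \<and> v \<bullet> z w \<le> a} =
      prob {w \<in> space M. a < u' \<bullet> z w \<and> v' \<bullet> z w \<le> a}"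
    using law[OF T(1), of "\<lambda>x. a < u' \<bullet> x \<and> v' \<bullet> x \<le> a"] by simp
  also have "\<dots> = (LBINT x:{a..}. gauss \<sigma> x * gauss_cdf \<sigma> ((a - x * cos \<theta>) / sin \<theta>))"
    using normal_pair_wedge[OF awgn_indep_components[OF z ij] awgn_component[OF z] awgn_component[OF z] \<sigma> pos]
    by (simp add: u'_def v'_def inner_add_left inner_axis')
  finally show "prob {w \<in> space M. a < u \<bullet> z w \<and> v \<bullet> z w \<le> a} =
      (LBINT x:{a..}. gauss \<sigma> x * gauss_cdf \<sigma> ((a - x * cos \<theta>) / sin \<theta>))" .
qed

section \<open>Monotonicity in the angle\<close>

lemma wedge_threshold_mono:
  fixes a x :: real
  assumes "0 < \<theta>" "\<theta> \<le> \<theta>'" "\<theta>' < pi" "0 \<le> a" "a \<le> x"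
  shows "(a - x * cos \<theta>) / sin \<theta> \<le> (a - x * cos \<theta>') / sin \<theta>'"
proof -
  \<comment> \<open>Cross-multiplying by the positive sines reduces the claim to \<open>a * (sin
    \<theta>' - sin \<theta>) \<le> x * sin (\<theta>' - \<theta>)\<close>. In terms of half-sum
    \<open>m\<close> and half-difference \<open>k\<close> both sides carry the factor
    \<open>2 * sin k\<close>, leaving \<open>a * cos m \<le> x * cos k\<close>.\<close>
  define m k where "m = (\<theta>' + \<theta>) / 2" and "k = (\<theta>' - \<theta>) / 2"
  have "\<theta> = m - k" "\<theta>' = m + k" by (simp_all add: m_def k_def field_simps)
  have k: "0 \<le> k" "k \<le> m" "m \<le> pi" "k \<le> pi / 2" using assms by (auto simp: m_def k_def)
  have "a * cos m \<le> a * cos k"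
    using k assms by (intro mult_left_mono cos_monotone_0_pi_le) auto
  also have "\<dots> \<le> x * cos k"
    using k assms by (intro mult_right_mono cos_ge_zero) auto
  finally have "2 * sin k * (a * cos m) \<le> 2 * sin k * (x * cos k)"
    using k by (intro mult_left_mono mult_nonneg_nonneg sin_ge_zero) auto
  moreover have "sin \<theta>' - sin \<theta> = 2 * sin k * cos m"
    by (simp add: \<open>\<theta> = m - k\<close> \<open>\<theta>' = m + k\<close> sin_add sin_diff)
  moreover have "sin \<theta>' * cos \<theta> - cos \<theta>' * sin \<theta> = 2 * sin k * cos k"
  proof -
    have "\<theta>' - \<theta> = 2 * k" by (simp add: k_def)
    then show ?thesis by (simp flip: sin_diff sin_double)
  qed
  ultimately have "a * (sin \<theta>' - sin \<theta>) \<le> x * (sin \<theta>' * cos \<theta> - cos \<theta>' * sin \<theta>)"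
    by (simp add: mult_ac)
  then have "(a - x * cos \<theta>) * sin \<theta>' \<le> (a - x * cos \<theta>') * sin \<theta>"
    by (simp add: algebra_simps)
  moreover have "0 < sin \<theta>" "0 < sin \<theta>'"
    using assms by (auto intro!: sin_gt_zero)
  ultimately show ?thesis
    by (simp add: pos_divide_le_eq pos_le_divide_eq)
qed

lemma triplet_error_eq:
  "triplet_error d \<sigma> \<theta> = Q (sqrt (real d) / \<sigma>) +
    (LBINT x:{sqrt (real d)..}. gauss \<sigma> x * gauss_cdf \<sigma> ((sqrt (real d) - x * cos \<theta>) / sin \<theta>))"
  by (simp add: triplet_error_def gauss_cdf_def)

lemma mono_triplet_error:
  assumes \<sigma>: "\<sigma> > 0"
  shows "mono_on {0<..<pi} (triplet_error d \<sigma>)"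
proof (rule mono_onI)
  fix \<theta> \<theta>' :: real
  assume \<theta>: "\<theta> \<in> {0<..<pi}" "\<theta>' \<in> {0<..<pi}" "\<theta> \<le> \<theta>'"
  let ?a = "sqrt (real d)"
  note [measurable] = measurable_gauss_cdf[OF \<sigma>]
  \<comment> \<open>Comparing the integrals requires integrability; since \<open>gauss_cdf\<close>
    lies between 0 and 1, the normal density dominates.\<close>
  have "set_integrable lborel {?a..} (\<lambda>x. gauss \<sigma> x * gauss_cdf \<sigma> ((?a - x * cos \<phi>) / sin \<phi>))" for \<phi>
    unfolding set_integrable_def
  proof (rule Bochner_Integration.integrable_bound)
    show "integrable lborel (normal_density 0 \<sigma>)" using \<sigma> by simp
    show "AE x in lborel. norm (indicat_real {?a..} x *\<^sub>R (gauss \<sigma> x * gauss_cdf \<sigma> ((?a - x * cos \<phi>) / sin \<phi>)))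
        \<le> norm (normal_density 0 \<sigma> x)"
      using gauss_cdf_nonneg[OF \<sigma>] gauss_cdf_le_1[OF \<sigma>]
      by (auto simp: gauss_eq_normal_density[OF \<sigma>] abs_mult mult_left_le split: split_indicator)
  qed (simp add: gauss_eq_normal_density[OF \<sigma>])
  then show "triplet_error d \<sigma> \<theta> \<le> triplet_error d \<sigma> \<theta>'"
    unfolding triplet_error_eq using \<theta>
    by (intro add_left_mono set_integral_mono mult_left_mono monoD[OF mono_gauss_cdf[OF \<sigma>]] wedge_threshold_mono)
      (auto simp: gauss_eq_normal_density[OF \<sigma>])
qed

section \<open>Geometry of the bipolar images\<close>

lemma bpsk_diff_nth: "(bpsk c - bpsk 0) $ t = - 2 * of_bit (c $ t)"
  by (simp add: bpsk_def)

lemma inj_bpsk: "bpsk c = bpsk c' \<Longrightarrow> c = c'"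
proof (rule vec_eq_iff[THEN iffD2], rule allI)
  fix t assume "bpsk c = bpsk c'"
  then have "bpsk c $ t = bpsk c' $ t" by simp
  then show "c $ t = c' $ t"
    by (cases "c $ t"; cases "c' $ t") (simp_all add: bpsk_def)
qed

lemma norm_bpsk_diff: "norm (bpsk c - bpsk 0) = 2 * sqrt (real (hamming_weight c))"
proof -
  have "(bpsk c - bpsk 0) \<bullet> (bpsk c - bpsk 0) = (\<Sum>t\<in>UNIV. if c $ t \<noteq> 0 then 4 else 0)"
    unfolding inner_vec_def by (intro sum.cong refl) (auto simp: bpsk_def)
  also have "\<dots> = 4 * real (hamming_weight c)"
    by (simp add: hamming_weight_def sum.If_cases)
  finally show ?thesis
    by (simp add: norm_eq_sqrt_inner real_sqrt_mult)
qed

text \<open>Every component of either difference is 0 or -2. This keeps the cosine of the angle away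
  from -1.\<close>

lemma inner_bpsk_diff_nonneg: "0 \<le> (bpsk c - bpsk 0) \<bullet> (bpsk c' - bpsk 0)"
  unfolding inner_vec_def
  by (intro sum_nonneg) (simp add: bpsk_diff_nth split: bit.splits del: vector_minus_component)

text \<open>Expanding the positive number \<open>(norm (u - v))\<^sup>2\<close> gives strictness in
  Cauchy-Schwarz; it excludes the angle 0.\<close>

lemma equal_norm_inner_less:
  fixes u v :: "'a::real_inner"
  assumes "norm u = norm v" "u \<noteq> v"
  shows "u \<bullet> v < norm u * norm v"
proof -
  have "0 < (norm (u - v))\<^sup>2" using assms(2) by simp
  also have "(norm (u - v))\<^sup>2 = (norm u)\<^sup>2 + (norm v)\<^sup>2 - 2 * (u \<bullet> v)"
    unfolding power2_norm_eq_inner by (simp add: inner_diff_left inner_diff_right inner_commute)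
  finally show ?thesis
    using assms(1) by (simp add: power2_eq_square)
qed

text \<open>In length one the weight determines the word, so two different words of equal weight
  force a second coordinate. It provides the second axis of the standard position.\<close>

lemma equal_weight_two_indices:
  fixes c c' :: "bit ^ 'n"
  assumes "hamming_weight c = hamming_weight c'" "c \<noteq> c'"
  obtains i j :: 'n where "i \<noteq> j"
proof -
  obtain i where i: "c $ i \<noteq> c' $ i" using assms(2) by (auto simp: vec_eq_iff)
  have "\<exists>j. j \<noteq> i"
  proof (rule ccontr)
    assume "\<not> ?thesis"
    then have "{t. b $ t \<noteq> 0} = (if b $ i = 0 then {} else {i})" for b :: "bit ^ 'n"
      by auto
    then show False
      using assms(1) i by (auto simp: hamming_weight_def split: if_splits)
  qed
  then show thesis using that by auto
qed

text \<open>The boundary is the perpendicular bisector of \<open>s\<close> and \<open>s'\<close>: on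
  squaring the distances the term \<open>z \<bullet> z\<close> cancels.\<close>

lemma dist_less_iff_inner:
  fixes z s s' :: "'a::real_inner"
  shows "dist (s + z) s' < dist (s + z) s \<longleftrightarrow> (norm (s' - s))\<^sup>2 < 2 * ((s' - s) \<bullet> z)"
proof -
  have "dist (s + z) s' = norm (z - (s' - s))" by (simp add: dist_norm algebra_simps)
  then have "dist (s + z) s' < dist (s + z) s \<longleftrightarrow> (z - (s' - s)) \<bullet> (z - (s' - s)) < z \<bullet> z"
    by (simp add: dist_norm norm_lt)
  moreover have "(z - u) \<bullet> (z - u) = z \<bullet> z - 2 * (u \<bullet> z) + (norm u)\<^sup>2" for u
    by (simp add: inner_diff_left inner_diff_right inner_commute power2_norm_eq_inner)
  ultimately show ?thesis by auto
qed

section \<open>The triplet-wise error probability\<close>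

theorem lemma3:
  fixes C :: "(bit ^ 'n) set"
    and c0 c1 c2 :: "bit ^ 'n"
    and d :: nat
    and \<sigma> \<theta> :: real
    and M :: "'w measure"
    and z y :: "'w \<Rightarrow> real ^ 'n"
  assumes "vec.subspace C"
    and "c0 = 0"
    and "c1 \<in> C" and "c2 \<in> C" and "c1 \<noteq> c2"
    and "d \<ge> 1" and "hamming_weight c1 = d" and "hamming_weight c2 = d"
    and "\<sigma> > 0"
    and "prob_space M" and "awgn M \<sigma> z"
    and "\<And>w. y w = bpsk c0 + z w"
    and "\<theta> = vec_angle (bpsk c1 - bpsk c0) (bpsk c2 - bpsk c0)"
  shows "measure M (error_event M y (bpsk c0) (bpsk c1) \<union> error_event M y (bpsk c0) (bpsk c2))
           = triplet_error d \<sigma> \<theta>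
       \<and> mono_on {0<..<pi} (triplet_error d \<sigma>)"
proof
  interpret prob_space M by fact
  note z = \<open>awgn M \<sigma> z\<close> and \<sigma> = \<open>\<sigma> > 0\<close>
  note [measurable] = awgn_measurable[OF z]
  define a where "a = sqrt (real d)"
  have a: "a > 0" "a\<^sup>2 = real d" using \<open>d \<ge> 1\<close> by (simp_all add: a_def)
  define s where "s c = bpsk c - bpsk 0" for c :: "bit ^ 'n"
  \<comment> \<open>The factor \<open>2 * a\<close> is the common length of both differences, by
    \<open>norm_bpsk_diff\<close>.\<close>
  define u v where "u = s c1 /\<^sub>R (2 * a)" and "v = s c2 /\<^sub>R (2 * a)"
  have norm_s: "norm (s c1) = 2 * a" "norm (s c2) = 2 * a"
    using assms by (simp_all add: s_def norm_bpsk_diff a_def)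
  then have unit: "norm u = 1" "norm v = 1"
    using a by (simp_all add: u_def v_def)
  have "u \<noteq> v"
    using \<open>c1 \<noteq> c2\<close> a inj_bpsk[of c1 c2] by (auto simp: u_def v_def s_def)
  then have uv_less: "u \<bullet> v < 1"
    using equal_norm_inner_less[of u v] unit by simp
  have uv_nonneg: "0 \<le> u \<bullet> v"
    using inner_bpsk_diff_nonneg[of c1 c2] a by (simp add: u_def v_def s_def)
  have \<theta>: "\<theta> = arccos (u \<bullet> v)"
    using assms(13) a norm_s by (simp add: vec_angle_def u_def v_def \<open>c0 = 0\<close> s_def[symmetric] field_simps)
  have cos: "u \<bullet> v = cos \<theta>"
    using uv_less uv_nonneg by (simp add: \<theta>)
  have sin: "sin \<theta> > 0"
    using uv_less uv_nonneg by (simp add: \<theta> sin_arccos abs_square_less_1)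
  obtain i j :: 'n where ij: "i \<noteq> j"
    using equal_weight_two_indices[of c1 c2] assms by auto
  \<comment> \<open>The condition \<open>4 * a\<^sup>2 < 2 * (s c \<bullet> z w)\<close> divided by
    \<open>4 * a\<close> has threshold \<open>a\<close> for the unit normal.\<close>
  have event: "error_event M y (bpsk c0) (bpsk c) = {w \<in> space M. a < (s c /\<^sub>R (2 * a)) \<bullet> z w}"
    if "norm (s c) = 2 * a" for c
    using a(1) that by (simp add: error_event_def assms(12) dist_less_iff_inner \<open>c0 = 0\<close> s_def[symmetric]
        power2_eq_square field_simps)
  have "error_event M y (bpsk c0) (bpsk c1) \<union> error_event M y (bpsk c0) (bpsk c2) =
      {w \<in> space M. a < v \<bullet> z w} \<union> {w \<in> space M. a < u \<bullet> z w \<and> v \<bullet> z w \<le> a}"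
    using norm_s by (auto simp: event u_def v_def)
  also have "prob \<dots> = prob {w \<in> space M. a < v \<bullet> z w} + prob {w \<in> space M. a < u \<bullet> z w \<and> v \<bullet> z w \<le> a}"
    by (rule finite_measure_Union) auto
  also have "\<dots> = triplet_error d \<sigma> \<theta>"
    unfolding triplet_error_eq a_def[symmetric]
      awgn_halfspace[OF z \<sigma> ij unit cos sin] awgn_wedge[OF z \<sigma> ij unit cos sin] ..
  finally show "prob (error_event M y (bpsk c0) (bpsk c1) \<union> error_event M y (bpsk c0) (bpsk c2)) =
      triplet_error d \<sigma> \<theta>" .
  show "mono_on {0<..<pi} (triplet_error d \<sigma>)"
    using \<sigma> by (rule mono_triplet_error)
qed

end
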